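(* For almost every (with respect to Lebesgue measure) $\alpha\in\mathbb{T}$ there exists a continuous function $\varphi:\mathbb{T}\to\mathbb{R}$ with zero mean ($\int_{\mathbb{T}}\varphi\,dx=0$) such that $\dim_H D^{s_-s_+}(\alpha,\varphi)\geq 1/2$ for all $s_-,s_+\in\{+,-\}$.
   Context: $\mathbb{T}=\mathbb{R}/\mathbb{Z}$, $Tx=x+\alpha$, $\dim_H$ is Hausdorff dimension. For $n\in\mathbb{Z}$: $\varphi^{(n)}(x)=\sum_{k=0}^{n-1}\varphi(x+k\alpha)$ for $n>0$, $\varphi^{(0)}=0$, $\varphi^{(n)}(x)=-\sum_{k=1}^{|n|}\varphi(x-k\alpha)$ for $n<0$. For $s_-,s_+\in\{-,+\}$, $D^{s_-s_+}(\alpha,\varphi)=\{x\in\mathbb{T}:\ \varphi^{(m)}(x)\to s_-\infty \text{ as } m\to-\infty \text{ and } \varphi^{(m)}(x)\to s_+\infty\text{ as }m\to+\infty\}$. *)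

theory Defs
  imports "HOL-Analysis.Analysis"
begin

definition int_cong :: "real \<Rightarrow> real \<Rightarrow> bool" where
  "int_cong x y \<longleftrightarrow> x - y \<in> \<int>"

lemma equivp_int_cong: "equivp int_cong"
proof (rule equivpI)
  show "reflp int_cong" by (simp add: reflp_def int_cong_def)
  show "symp int_cong"
    unfolding symp_def int_cong_def by (metis Ints_minus minus_diff_eq)
  show "transp int_cong"
    unfolding transp_def int_cong_def by (metis Ints_add diff_add_cancel add_diff_eq)
qed

quotient_type circle = real / int_cong
  morphisms rep_circle circle_of
  by (rule equivp_int_cong)

definition int_dist :: "real \<Rightarrow> real" where
  "int_dist x = \<bar>x - of_int (round x)\<bar>"

lemma int_dist_le: "int_dist x \<le> \<bar>x - of_int m\<bar>"
  unfolding int_dist_def by (rule round_diff_minimal)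

lemma int_dist_add_int: "int_dist (x + of_int m) = int_dist x"
proof (rule antisym)
  show "int_dist (x + of_int m) \<le> int_dist x"
    using int_dist_le[of "x + of_int m" "round x + m"] by (simp add: int_dist_def)
  show "int_dist x \<le> int_dist (x + of_int m)"
    using int_dist_le[of x "round (x + of_int m) - m"]
    by (simp add: int_dist_def algebra_simps)
qed

lemma int_dist_minus: "int_dist (- x) = int_dist x"
proof -
  have le: "int_dist (- y) \<le> int_dist y" for y
    using int_dist_le[of "- y" "- round y"] by (simp add: int_dist_def abs_if split: if_splits)
  show ?thesis using le[of x] le[of "- x"] by simp
qed

lemma int_dist_triangle: "int_dist (x + y) \<le> int_dist x + int_dist y"
  using int_dist_le[of "x + y" "round x + round y"] by (simp add: int_dist_def)

lemma int_dist_eq_0_iff: "int_dist x = 0 \<longleftrightarrow> x \<in> \<int>"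
proof
  assume "int_dist x = 0"
  then have "x = of_int (round x)" by (simp add: int_dist_def)
  then show "x \<in> \<int>" by (metis Ints_of_int)
next
  assume "x \<in> \<int>"
  then show "int_dist x = 0" by (auto simp: int_dist_def elim: Ints_cases)
qed

instantiation circle :: ab_group_add
begin

lift_definition zero_circle :: circle is 0 .

lift_definition plus_circle :: "circle \<Rightarrow> circle \<Rightarrow> circle" is "(+)"
  unfolding int_cong_def by (metis Ints_add add_diff_add)

lift_definition uminus_circle :: "circle \<Rightarrow> circle" is uminus
  unfolding int_cong_def by (metis Ints_minus minus_diff_eq minus_diff_minus)

lift_definition minus_circle :: "circle \<Rightarrow> circle \<Rightarrow> circle" is "(-)"
  unfolding int_cong_def by (metis Ints_diff diff_diff_eq diff_diff_eq2 diff_add_eq add.commute)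

instance
  by standard (transfer; simp add: int_cong_def algebra_simps)+

end

instantiation circle :: metric_space
begin

lift_definition dist_circle :: "circle \<Rightarrow> circle \<Rightarrow> real" is "\<lambda>x y. int_dist (x - y)"
proof -
  fix x x' y y' :: real
  assume "int_cong x x'" "int_cong y y'"
  then obtain m n where "x - x' = of_int m" "y - y' = of_int n"
    unfolding int_cong_def by (auto elim!: Ints_cases)
  then have "x - y = (x' - y') + of_int (m - n)" by simp
  then show "int_dist (x - y) = int_dist (x' - y')" by (metis int_dist_add_int)
qed

definition uniformity_circle :: "(circle \<times> circle) filter" where
  "uniformity_circle = (INF e\<in>{0 <..}. principal {(x, y). dist x y < e})"

definition open_circle :: "circle set \<Rightarrow> bool" where
  "open_circle U \<longleftrightarrow> (\<forall>x\<in>U. eventually (\<lambda>(x', y). x' = x \<longrightarrow> y \<in> U) uniformity)"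

instance
proof
  fix x y z :: circle
  show "dist x y = 0 \<longleftrightarrow> x = y"
    by transfer (simp add: int_dist_eq_0_iff int_cong_def)
  show "dist x y \<le> dist x z + dist y z"
  proof transfer
    fix x y z :: real
    show "int_dist (x - y) \<le> int_dist (x - z) + int_dist (y - z)"
      using int_dist_triangle[of "x - z" "z - y"] int_dist_minus[of "y - z"] by simp
  qed
qed (simp_all add: uniformity_circle_def open_circle_def)

end

lemma continuous_on_circle_of: "continuous_on A circle_of"
proof -
  have "dist (circle_of x) (circle_of y) \<le> dist x y" for x y
    using int_dist_le[of "x - y" 0] by (simp add: dist_circle.abs_eq dist_real_def)
  then show ?thesis
    unfolding continuous_on_iff by (meson order.strict_trans1)
qed

definition circle_lebesgue :: "circle measure" where
  "circle_lebesgue = distr (restrict_space lborel {0..<1}) borel circle_of"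

lemma emeasure_circle_lebesgue_UNIV: "emeasure circle_lebesgue UNIV = 1"
proof -
  have "circle_of \<in> measurable (restrict_space lborel {0..<1}) borel"
    by (intro measurable_restrict_space1)
       (simp add: borel_measurable_continuous_onI continuous_on_circle_of)
  then show ?thesis
    by (simp add: circle_lebesgue_def emeasure_distr space_restrict_space emeasure_restrict_space)
qed

lift_definition int_multiple :: "int \<Rightarrow> circle \<Rightarrow> circle" is "\<lambda>k x. of_int k * x"
  unfolding int_cong_def by (metis Ints_mult Ints_of_int right_diff_distrib)

text \<open>
  The Hausdorff content and measure are only used for exponents \<open>s > 0\<close>: since \<^term>\<open>0 powr 0 = (0::real)\<close>, the value
  at \<open>s = 0\<close> is not the counting measure. The infimum defining the dimension is insensitive to the value at \<open>0\<close>.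
  Boundedness is required because \<^const>\<open>diameter\<close> is only meaningful for bounded sets.
\<close>

definition hausdorff_content :: "real \<Rightarrow> real \<Rightarrow> 'a::metric_space set \<Rightarrow> ennreal" where
  "hausdorff_content s \<delta> A =
     Inf {(\<Sum>n. ennreal (diameter (U n) powr s)) | U :: nat \<Rightarrow> 'a set.
            A \<subseteq> (\<Union>n. U n) \<and> (\<forall>n. bounded (U n) \<and> diameter (U n) \<le> \<delta>)}"

definition hausdorff_measure :: "real \<Rightarrow> 'a::metric_space set \<Rightarrow> ennreal" where
  "hausdorff_measure s A = (SUP \<delta>\<in>{0<..}. hausdorff_content s \<delta> A)"

definition hausdorff_dim :: "'a::metric_space set \<Rightarrow> ennreal" where
  "hausdorff_dim A = Inf {ennreal s | s. s > 0 \<and> hausdorff_measure s A = 0}"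

definition birkhoff_sum :: "circle \<Rightarrow> (circle \<Rightarrow> real) \<Rightarrow> int \<Rightarrow> circle \<Rightarrow> real" where
  "birkhoff_sum \<alpha> \<phi> n x =
     (if n \<ge> 0 then (\<Sum>k\<in>{0..n - 1}. \<phi> (x + int_multiple k \<alpha>))
      else - (\<Sum>k\<in>{1..\<bar>n\<bar>}. \<phi> (x - int_multiple k \<alpha>)))"

datatype sign = Minus | Plus

fun signed_infinity :: "sign \<Rightarrow> real filter" where
  "signed_infinity Minus = at_bot"
| "signed_infinity Plus = at_top"

definition divergence_set :: "sign \<Rightarrow> sign \<Rightarrow> circle \<Rightarrow> (circle \<Rightarrow> real) \<Rightarrow> circle set" where
  "divergence_set s1 s2 \<alpha> \<phi> =
     {x. filterlim (\<lambda>m. birkhoff_sum \<alpha> \<phi> m x) (signed_infinity s1) at_bot \<and>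
         filterlim (\<lambda>m. birkhoff_sum \<alpha> \<phi> m x) (signed_infinity s2) at_top}"

end

theory Submission
  imports Defs "HOL-Analysis.Kronecker_Approximation_Theorem"
begin

text \<open>
  Every irrational \<open>a\<close> works. Density of the multiples of \<open>a\<close> modulo 1 gives integers \<open>q\<^sub>k\<close>, as sparse as
  we like, such that \<open>\<delta>\<^sub>k = q\<^sub>k a\<close> lies modulo 1 between \<open>16\<^bsup>-k-1\<^esup>\<close> and twice that. Let \<open>G\<close> be a 1-periodic
  Lipschitz wave with values in \<open>[-1, 1]\<close> and put \<open>g\<^sub>k(t) = 8\<^bsup>k\<^esup> G(q\<^sub>k t)\<close>. The coboundaries
  \<open>g\<^sub>k(t + a) - g\<^sub>k(t)\<close> are of size \<open>2\<^bsup>-k\<^esup>\<close>, so their sum is continuous and has mean zero, and its \<open>m\<close>-th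
  Birkhoff sum is the sum over \<open>k\<close> of \<open>8\<^bsup>k\<^esup> (G(q\<^sub>k t + m \<delta>\<^sub>k) - G(q\<^sub>k t))\<close>.

  The wave has four zeros, one for each pair of signs, around which it has the prescribed sign on either
  side and reaches height 1 very quickly. If every \<open>q\<^sub>k t\<close> is within \<open>O(16\<^bsup>-k\<^esup>)\<close> of such a zero, then for
  \<open>16\<^bsup>k-1\<^esup> \<le> m < 16\<^bsup>k\<^esup>\<close> the \<open>k\<close>-th summand equals \<open>8\<^bsup>k\<^esup>\<close> up to sign, which beats the earlier ones, and the
  later ones have the right sign, up to a bounded total error. Hence the Birkhoff sums diverge at \<open>t\<close>
  as prescribed.

  These \<open>t\<close> form a Cantor set. As \<open>q\<^sub>k\<close> can be chosen arbitrarily large while \<open>\<delta>\<^sub>k\<close> keeps its size, the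
  inverse of the natural parametrization of the Cantor set by \<open>[0, 1)\<close> is Hoelder with exponent \<open>1/2\<close>,
  which bounds the Hausdorff dimension from below.
\<close>

section \<open>Hausdorff dimension and irrational rotations\<close>

text \<open>A cover of \<open>A\<close> by sets of diameter at most 1 pulls back under
  \<open>\<gamma>\<close> to a cover of [0,1) whose n-th piece lies in an interval of length
  \<open>2 * C * diameter (U n) powr s\<close>. Countable subadditivity of Lebesgue measure then
  keeps the content at least \<open>1 / (2 * C)\<close> whenever 0 < s \<le> t.\<close>

lemma hausdorff_dim_ge_inverse_holder:
  fixes \<gamma> :: "real \<Rightarrow> 'a::metric_space"
  assumes C: "C > 0" and t: "t > 0"
    and sep: "\<And>u v. u \<in> {0..<1} \<Longrightarrow> v \<in> {0..<1} \<Longrightarrow> \<bar>u - v\<bar> \<le> C * dist (\<gamma> u) (\<gamma> v) powr t"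
    and img: "\<gamma> ` {0..<1} \<subseteq> A"
  shows "hausdorff_dim A \<ge> ennreal t"
proof -
  have "t \<le> s" if s: "s > 0" and null: "hausdorff_measure s A = 0" for s
  proof (rule ccontr)
    assume "\<not> t \<le> s"
    then have st: "s \<le> t" by simp
    have "ennreal (1 / (2 * C)) \<le> (\<Sum>n. ennreal (diameter (U n) powr s))"
      if cov: "A \<subseteq> (\<Union>n. U n)" and U: "\<And>n. bounded (U n)" "\<And>n. diameter (U n) \<le> 1" for U :: "nat \<Rightarrow> 'a set"
    proof -
      define w where "w n = C * diameter (U n) powr s" for n
      have "\<exists>c. {u\<in>{0..<1}. \<gamma> u \<in> U n} \<subseteq> {c - w n..c + w n}" for n
      proof (cases "{u\<in>{0..<1}. \<gamma> u \<in> U n} = {}")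
        case False
        then obtain c where c: "c \<in> {0..<1}" "\<gamma> c \<in> U n" by blast
        have "\<bar>u - c\<bar> \<le> w n" if u: "u \<in> {0..<1}" "\<gamma> u \<in> U n" for u
        proof -
          have "\<bar>u - c\<bar> \<le> C * dist (\<gamma> u) (\<gamma> c) powr t" using sep u c by blast
          also have "\<dots> \<le> C * diameter (U n) powr t"
            using C t diameter_bounded_bound[OF U(1) u(2) c(2)]
            by (intro mult_left_mono powr_mono2) auto
          \<comment> \<open>Diameters are at most 1, so lowering the exponent from \<open>t\<close>
            to \<open>s\<close> only enlarges the power.\<close>
          also have "\<dots> \<le> w n"
            unfolding w_def using C U st diameter_ge_0[OF U(1)[of n]]
            by (intro mult_left_mono powr_mono') auto
          finally show ?thesis .
        qed
        then show ?thesis by (intro exI[of _ c]) (fastforce simp: abs_le_iff)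
      qed auto
      then obtain c where c: "\<And>n. {u\<in>{0..<1}. \<gamma> u \<in> U n} \<subseteq> {c n - w n..c n + w n}" by metis
      have w0: "w n \<ge> 0" for n using C by (simp add: w_def)
      have "{0..<1} \<subseteq> (\<Union>n. {c n - w n..c n + w n})"
      proof
        fix u :: real assume u: "u \<in> {0..<1}"
        then obtain n where "\<gamma> u \<in> U n" using cov img by blast
        then show "u \<in> (\<Union>n. {c n - w n..c n + w n})" using c[of n] u by blast
      qed
      then have "emeasure lborel {0..<1::real} \<le> emeasure lborel (\<Union>n. {c n - w n..c n + w n})"
        by (intro emeasure_mono) auto
      also have "\<dots> \<le> (\<Sum>n. emeasure lborel {c n - w n..c n + w n})"
        by (intro emeasure_subadditive_countably) auto
      also have "\<dots> = (\<Sum>n. ennreal (2 * C) * ennreal (diameter (U n) powr s))"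
        using w0 C by (intro suminf_cong) (simp add: w_def flip: ennreal_mult)
      also have "\<dots> = ennreal (2 * C) * (\<Sum>n. ennreal (diameter (U n) powr s))"
        by simp
      finally have "ennreal (1 / (2 * C)) * 1 \<le> ennreal (1 / (2 * C)) * (ennreal (2 * C) * (\<Sum>n. ennreal (diameter (U n) powr s)))"
        by (intro mult_left_mono) auto
      also have "\<dots> = (\<Sum>n. ennreal (diameter (U n) powr s))"
        using C by (simp add: mult.assoc[symmetric] flip: ennreal_mult)
      finally show ?thesis by simp
    qed
    then have "ennreal (1 / (2 * C)) \<le> hausdorff_content s 1 A"
      unfolding hausdorff_content_def by (intro Inf_greatest) auto
    also have "\<dots> \<le> hausdorff_measure s A"
      unfolding hausdorff_measure_def by (intro SUP_upper) auto
    finally show False using null C by simp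
  qed
  then show ?thesis
    unfolding hausdorff_dim_def by (intro Inf_greatest) (auto intro!: ennreal_leI)
qed

lemma irrational_multiple_in_window:
  fixes a c d :: real
  assumes "a \<notin> \<rat>" "c < d"
  obtains q :: nat and p :: int where "q > Q" "c < real q * a - of_int p" "real q * a - of_int p < d"
proof -
  \<comment> \<open>The target is the midpoint of the window shifted by \<open>- Q * a\<close>, so
    that adding \<open>Q\<close> to the positive \<open>k\<close> gives a multiplier above
    \<open>Q\<close>.\<close>
  obtain h k where k: "k > 0" "\<bar>of_int k * a - of_int h - ((c + d) / 2 - real Q * a)\<bar> < (d - c) / 2"
    using sequence_of_fractional_parts_is_dense[OF assms(1), of "(d - c) / 2"] assms(2)
    by (metis diff_gt_0_iff_gt half_gt_zero)
  have "real (Q + nat k) = real Q + of_int k" using k by simp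
  with k(2) have "c < real (Q + nat k) * a - of_int h" "real (Q + nat k) * a - of_int h < d"
    by (simp_all add: abs_less_iff field_simps)
  with k(1) show thesis by (intro that[of "Q + nat k" h]) auto
qed

text \<open>All representatives of a rational class are rational, so the exceptional set is
  countable and its preimage in [0,1) is a null set.\<close>

lemma AE_circle_lebesgue_irrational:
  "AE \<alpha> in circle_lebesgue. \<exists>a. \<alpha> = circle_of a \<and> a \<notin> \<rat>"
proof (rule AE_I')
  have meas: "circle_of \<in> measurable (restrict_space lborel {0..<1}) borel"
    by (intro measurable_restrict_space1)
       (simp add: borel_measurable_continuous_onI continuous_on_circle_of)
  have cnt: "countable (circle_of ` \<rat>)" by (intro countable_image countable_rat)
  have "(\<Union>x\<in>circle_of ` \<rat>. {x}) \<in> sets borel"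
    by (intro sets.countable_UN'[OF cnt]) auto
  then have S: "circle_of ` \<rat> \<in> sets borel" by simp
  have rat: "circle_of x \<in> circle_of ` \<rat> \<longleftrightarrow> x \<in> \<rat>" for x
  proof
    assume "circle_of x \<in> circle_of ` \<rat>"
    then obtain y where y: "y \<in> \<rat>" "int_cong x y" by (auto simp: circle.abs_eq_iff)
    then have "x - y \<in> \<rat>" by (auto simp: int_cong_def elim: Ints_cases)
    then show "x \<in> \<rat>" using y(1) Rats_add[of "x - y" y] by simp
  qed auto
  have pre: "circle_of -` circle_of ` \<rat> \<inter> {0..<1} = \<rat> \<inter> {0..<1}"
    using rat by blast
  have "emeasure lborel (\<rat> \<inter> {0..<1::real}) = 0"
    by (intro emeasure_lborel_countable countable_subset[OF _ countable_rat]) auto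
  then have "emeasure circle_lebesgue (circle_of ` \<rat>) = 0"
    unfolding circle_lebesgue_def
    by (subst emeasure_distr[OF meas S])
       (simp add: space_restrict_space emeasure_restrict_space pre)
  then show "circle_of ` \<rat> \<in> null_sets circle_lebesgue"
    using S by (auto simp: null_sets_def circle_lebesgue_def)
  show "{\<alpha> \<in> space circle_lebesgue. \<not> (\<exists>a. \<alpha> = circle_of a \<and> a \<notin> \<rat>)} \<subseteq> circle_of ` \<rat>"
  proof safe
    fix \<alpha> assume *: "\<nexists>a. \<alpha> = circle_of a \<and> a \<notin> \<rat>"
    have "circle_of (rep_circle \<alpha>) = \<alpha>" by (rule Quotient3_abs_rep[OF Quotient3_circle])
    then show "\<alpha> \<in> circle_of ` \<rat>" using * by (metis image_eqI)
  qed
qed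

section \<open>Cantor sets with prescribed phases\<close>

text \<open>An interval of level k has length \<open>r k\<close>, on which \<open>q k\<close> sweeps
  the phases from \<open>\<theta>\<close> to \<open>\<theta> + \<eta> k\<close>. It contains
  \<open>N k\<close> intervals of the next level, and the mixed radix digits of \<open>u\<close>
  select a nested sequence shrinking to \<open>X u\<close>. The second conclusion compares, at the
  first level where \<open>u\<close> and \<open>v\<close> part, the gap between their intervals with
  the length of the cells of [0,1).\<close>

lemma nested_phase_points:
  fixes q \<eta> :: "nat \<Rightarrow> real" and \<theta> :: real
  defines "r \<equiv> \<lambda>k. \<eta> k / q k"
  assumes \<theta>: "0 \<le> \<theta>" "\<theta> < 1" and \<eta>: "\<And>k. 0 < \<eta> k" "\<And>k. \<eta> k \<le> 1 / 2" and q: "\<And>k. 1 \<le> q k"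
    and many: "\<And>k. 8 \<le> q (Suc k) * r k" and fast: "\<And>k. 64 \<le> \<eta> (Suc k) * q (Suc k) * (r k)\<^sup>2"
  obtains X :: "real \<Rightarrow> real" where
    "\<And>u k. u \<in> {0..<1} \<Longrightarrow> \<exists>p::int. q k * X u \<in> {of_int p + \<theta>..of_int p + \<theta> + \<eta> k}"
    "\<And>u v. u \<in> {0..<1} \<Longrightarrow> v \<in> {0..<1} \<Longrightarrow> (u - v)\<^sup>2 \<le> 64 / r 0 * \<bar>X u - X v\<bar>"
    "\<And>u v. u \<in> {0..<1} \<Longrightarrow> v \<in> {0..<1} \<Longrightarrow> \<bar>X u - X v\<bar> \<le> 1 / 2"
proof -
  have q0: "q k > 0" for k using q[of k] by simp
  have r0: "r k > 0" for k using \<eta> q0 by (simp add: r_def)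
  have rq: "q k * r k = \<eta> k" for k using q0[of k] by (simp add: r_def)
  \<comment> \<open>About \<open>q (Suc k) * r k\<close> points of phase \<open>\<theta>\<close> lie
    in an interval of level k. Using a quarter of them leaves room for rounding and for the width of
    the last child, while \<open>many\<close> still gives at least two children.\<close>
  define N :: "nat \<Rightarrow> int" where "N k = \<lfloor>q (Suc k) * r k / 4\<rfloor>" for k
  define M :: "nat \<Rightarrow> int" where "M = rec_nat 1 (\<lambda>k y. N k * y)"
  have M_0: "M 0 = 1" and M_Suc: "M (Suc k) = N k * M k" for k by (simp_all add: M_def)
  have N2: "N k \<ge> 2" for k using many[of k] by (simp add: N_def le_floor_iff)
  have N_le: "of_int (N k) \<le> q (Suc k) * r k / 4" for k unfolding N_def by (rule of_int_floor_le)
  have N_ge: "of_int (N k) \<ge> q (Suc k) * r k / 8" for k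
  proof -
    have "of_int (N k) > q (Suc k) * r k / 4 - 1" unfolding N_def by linarith
    then show ?thesis using many[of k] by simp
  qed
  have M_ge: "M k \<ge> 2 ^ k" for k
  proof (induction k)
    case (Suc k)
    have "2 * 2 ^ k \<le> N k * M k" using Suc N2[of k] by (intro mult_mono) auto
    then show ?case by (simp add: M_Suc)
  qed (simp add: M_0)
  have M1: "M k \<ge> 1" for k using M_ge[of k] one_le_power[of "2::int" k] by linarith
  \<comment> \<open>The source of the exponent 1/2: the number \<open>M k\<close> of intervals is at
    least of order \<open>r k\<close> to the power -1/2. By \<open>fast\<close>, the last factor of
    \<open>M k\<close> alone achieves this.\<close>
  have Mr: "r 0 \<le> (of_int (M k))\<^sup>2 * r k" for k
  proof (cases k)
    case 0
    then show ?thesis by (simp add: M_0)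
  next
    case (Suc j)
    have "r 0 \<le> 1" using \<eta>(2)[of 0] q[of 0] by (simp add: r_def divide_le_eq)
    also have "1 \<le> (q (Suc j) * r j / 8)\<^sup>2 * r (Suc j)"
      using fast[of j] q0[of "Suc j"] by (simp add: r_def field_simps power2_eq_square)
    also have "\<dots> \<le> (of_int (N j))\<^sup>2 * r (Suc j)"
      using N_ge[of j] many[of j] r0[of "Suc j"] by (intro mult_right_mono power_mono) auto
    also have "\<dots> \<le> (of_int (M k))\<^sup>2 * r (Suc j)"
    proof -
      have "N j \<le> N j * M j" using mult_left_mono[of 1 "M j" "N j"] M1[of j] N2[of j] by simp
      then show ?thesis using N2[of j] r0[of "Suc j"] Suc
        by (intro mult_right_mono power_mono) (auto simp: M_Suc)
    qed
    finally show ?thesis by (simp add: Suc)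
  qed
  define m :: "real \<Rightarrow> nat \<Rightarrow> int" where "m u k = \<lfloor>of_int (M k) * u\<rfloor>" for u k
  have digit: "0 \<le> m u (Suc k) - N k * m u k" "m u (Suc k) - N k * m u k < N k" for u k
  proof -
    have "of_int (m u k) \<le> of_int (M k) * u" by (simp add: m_def)
    then have "of_int (N k) * of_int (m u k) \<le> of_int (N k) * (of_int (M k) * u)"
      using N2[of k] by (intro mult_left_mono) auto
    then have "of_int (N k * m u k) \<le> of_int (M (Suc k)) * u" by (simp add: M_Suc mult.assoc)
    then show "0 \<le> m u (Suc k) - N k * m u k" by (simp add: m_def[of u "Suc k"] le_floor_iff)
    have "of_int (M k) * u < of_int (m u k) + 1" by (simp add: m_def)
    then have "of_int (N k) * (of_int (M k) * u) < of_int (N k) * (of_int (m u k) + 1)"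
      using N2[of k] by (intro mult_strict_left_mono) auto
    then have "of_int (M (Suc k)) * u < of_int (N k * m u k + N k)"
      by (simp add: M_Suc algebra_simps)
    then have "m u (Suc k) < N k * m u k + N k" by (simp only: m_def[of u "Suc k"] floor_less_iff)
    then show "m u (Suc k) - N k * m u k < N k" by simp
  qed
  have m_back: "m u k = m v k" if "m u (Suc k) = m v (Suc k)" for u v k
  proof -
    have "m w (Suc k) div N k = m w k" for w
      using digit[of w k] by (intro int_div_pos_eq[where r = "m w (Suc k) - N k * m w k"]) auto
    then show ?thesis using that by metis
  qed
  \<comment> \<open>\<open>m u (Suc k) - N k * m u k\<close> is the \<open>k\<close>-th digit of \<open>u\<close> in the mixed radix system with bases \<open>N\<close>;
    it selects one of the \<open>N k\<close> points of phase \<open>\<theta>\<close> modulo \<open>1 / q (Suc k)\<close> to the right of \<open>x u k\<close>.\<close>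
  define x where "x u = rec_nat (\<theta> / q 0)
    (\<lambda>k y. (of_int (\<lceil>q (Suc k) * y\<rceil> + (m u (Suc k) - N k * m u k)) + \<theta>) / q (Suc k))" for u
  have x_0: "x u 0 = \<theta> / q 0" for u by (simp add: x_def)
  have x_Suc: "x u (Suc k) = (of_int (\<lceil>q (Suc k) * x u k\<rceil> + (m u (Suc k) - N k * m u k)) + \<theta>) / q (Suc k)"
    for u k by (simp add: x_def)
  have x_int: "\<exists>p::int. q k * x u k = of_int p + \<theta>" for u k
  proof (cases k)
    case 0
    then show ?thesis using q0[of 0] by (auto simp: x_0 intro: exI[of _ 0])
  next
    case (Suc j)
    then show ?thesis using q0[of "Suc j"] unfolding Suc x_Suc by (auto simp del: of_int_add of_int_diff)
  qed
  \<comment> \<open>The intervals from \<open>x u k\<close> to \<open>x u k + r k\<close> are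
    nested: rounding up, the digit and \<open>\<theta>\<close> shift by at most
    \<open>N k + 1\<close> units of \<open>1 / q (Suc k)\<close>, and the child adds at most half a
    unit.\<close>
  have step: "x u k \<le> x u (Suc k)" "x u (Suc k) + r (Suc k) \<le> x u k + r k" for u k
  proof -
    let ?d = "m u (Suc k) - N k * m u k" and ?Q = "q (Suc k)"
    have eq: "?Q * x u (Suc k) = of_int \<lceil>?Q * x u k\<rceil> + of_int ?d + \<theta>"
      using q0[of "Suc k"] by (simp add: x_Suc)
    have "?Q * x u k \<le> ?Q * x u (Suc k)"
      unfolding eq using digit(1)[of u k] \<theta> by linarith
    then show "x u k \<le> x u (Suc k)" using q0[of "Suc k"] by simp
    have "of_int ?d \<le> of_int (N k) - (1::real)" using digit(2)[of u k] by linarith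
    then have "?Q * x u (Suc k) \<le> ?Q * x u k + of_int (N k) + 1"
      unfolding eq using \<theta> by linarith
    then have "?Q * x u (Suc k) + ?Q * r (Suc k) \<le> ?Q * x u k + ?Q * r k"
      using N_le[of k] many[of k] \<eta>(2)[of "Suc k"] rq[of "Suc k"] by linarith
    then have "?Q * (x u (Suc k) + r (Suc k)) \<le> ?Q * (x u k + r k)" by (simp add: distrib_left)
    then show "x u (Suc k) + r (Suc k) \<le> x u k + r k" using q0[of "Suc k"] by simp
  qed
  have inc: "incseq (x u)" for u using step(1) by (rule incseq_SucI)
  have dec: "decseq (\<lambda>k. x u k + r k)" for u using step(2) by (rule decseq_SucI)
  have le: "x u i \<le> x u k + r k" for u i k
  proof -
    have "x u i \<le> x u (max i k)" using inc by (auto simp: incseq_def)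
    also have "\<dots> \<le> x u (max i k) + r (max i k)" using r0[of "max i k"] by simp
    also have "\<dots> \<le> x u k + r k" using dec[of u] by (auto simp: decseq_def)
    finally show ?thesis .
  qed
  define X where "X u = (SUP k. x u k)" for u
  have bdd: "bdd_above (range (x u))" for u
    by (rule bdd_aboveI[of _ "x u 0 + r 0"]) (use le in auto)
  have X_lo: "x u k \<le> X u" for u k unfolding X_def by (intro cSUP_upper bdd) auto
  have X_hi: "X u \<le> x u k + r k" for u k unfolding X_def by (intro cSUP_least le) auto
  show thesis
  proof
    fix u k
    obtain p :: int where "q k * x u k = of_int p + \<theta>" using x_int by blast
    moreover have "q k * x u k \<le> q k * X u" "q k * X u \<le> q k * (x u k + r k)"
      using X_lo X_hi q0[of k] by simp_all
    ultimately show "\<exists>p::int. q k * X u \<in> {of_int p + \<theta>..of_int p + \<theta> + \<eta> k}"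
      by (intro exI[of _ p]) (auto simp: distrib_left rq)
  next
    fix u v
    have "1 * r 0 \<le> q 0 * r 0" using q[of 0] r0[of 0] by (intro mult_right_mono) auto
    then have "r 0 \<le> 1 / 2" using \<eta>(2)[of 0] by (simp add: rq)
    then show "\<bar>X u - X v\<bar> \<le> 1 / 2"
      using X_lo[of u 0] X_lo[of v 0] X_hi[of u 0] X_hi[of v 0] unfolding x_0 by linarith
  next
    fix u v :: real assume uv: "u \<in> {0..<1}" "v \<in> {0..<1}"
    show "(u - v)\<^sup>2 \<le> 64 / r 0 * \<bar>X u - X v\<bar>"
    proof (cases "u = v")
      case False
      obtain n where n: "1 < 2 ^ n * \<bar>u - v\<bar>"
      proof -
        obtain n where "1 / \<bar>u - v\<bar> < 2 ^ n" using real_arch_pow[of 2] by auto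
        then show thesis using False that by (simp add: field_simps)
      qed
      have "m u n \<noteq> m v n"
      proof
        assume "m u n = m v n"
        then have "\<bar>of_int (M n) * u - of_int (M n) * v\<bar> < 1" unfolding m_def by linarith
        moreover have "2 ^ n * \<bar>u - v\<bar> \<le> of_int (M n) * \<bar>u - v\<bar>"
        proof (rule mult_right_mono)
          have "real_of_int (2 ^ n) \<le> of_int (M n)" using M_ge by (simp only: of_int_le_iff)
          then show "2 ^ n \<le> real_of_int (M n)" by simp
        qed auto
        moreover have "of_int (M n) * \<bar>u - v\<bar> = \<bar>of_int (M n) * u - of_int (M n) * v\<bar>"
          using M1[of n] by (simp add: abs_mult flip: right_diff_distrib)
        ultimately show False using n by linarith
      qed
      \<comment> \<open>The first level at which \<open>u\<close> and \<open>v\<close> are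
        separated; it is positive because level 0 has a single cell.\<close>
      define K where "K = (LEAST n. m u n \<noteq> m v n)"
      have K: "m u K \<noteq> m v K" unfolding K_def by (rule LeastI) fact
      have below: "m u j = m v j" if "j < K" for j
        using not_less_Least[of j "\<lambda>n. m u n \<noteq> m v n"] that by (auto simp: K_def)
      have "K \<noteq> 0"
      proof
        assume "K = 0"
        moreover have "\<lfloor>w\<rfloor> = 0" if "w \<in> {0..<1}" for w :: real
          using that by (simp add: floor_eq_iff)
        ultimately show False using K uv by (simp add: m_def M_0)
      qed
      then obtain k where k: "K = Suc k" by (cases K) auto
      have xeq: "x u j = x v j" if "j < K" for j
        using that
      proof (induction j)
        case (Suc j)
        then show ?case using below[of j] below[of "Suc j"] by (simp add: x_Suc)
      qed (simp add: x_0)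
      define \<Delta> where "\<Delta> = real_of_int \<bar>m u K - m v K\<bar>"
      have \<Delta>1: "\<Delta> \<ge> 1" using K by (simp add: \<Delta>_def)
      have \<Delta>N: "\<Delta> \<le> of_int (N k)"
        using digit[of u k] digit[of v k] below[of k] by (auto simp: \<Delta>_def k)
      \<comment> \<open>The parents coincide, so both points come from the same ceiling and only
        their digits differ.\<close>
      have "q K * x u K - q K * x v K = of_int (m u K - m v K)"
        using q0[of K] xeq[of k] below[of k] by (simp add: k x_Suc)
      then have "\<bar>q K * x u K - q K * x v K\<bar> = \<Delta>" by (simp add: \<Delta>_def)
      moreover have "q K * x w K \<le> q K * X w" "q K * X w \<le> q K * x w K + 1 / 2" for w
      proof -
        have "q K * X w \<le> q K * (x w K + r K)" using X_hi q0[of K] by simp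
        then show "q K * X w \<le> q K * x w K + 1 / 2" using \<eta>(2)[of K] by (simp add: distrib_left rq)
      qed (use X_lo q0[of K] in simp)
      from this[of u] this[of v] have "\<bar>(q K * X u - q K * X v) - (q K * x u K - q K * x v K)\<bar> \<le> 1 / 2"
        by linarith
      \<comment> \<open>Passing to the limit points costs at most 1/2, hence at most half of
        \<open>\<Delta>\<close>.\<close>
      ultimately have "\<Delta> / 2 \<le> \<bar>q K * X u - q K * X v\<bar>" using \<Delta>1 by linarith
      also have "\<dots> = q K * \<bar>X u - X v\<bar>" using q0[of K] by (simp add: abs_mult flip: right_diff_distrib)
      finally have sep: "\<Delta> \<le> 2 * q K * \<bar>X u - X v\<bar>" by simp
      have "\<bar>of_int (M K) * u - of_int (M K) * v\<bar> \<le> \<Delta> + 1" unfolding \<Delta>_def m_def by linarith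
      then have "of_int (M K) * \<bar>u - v\<bar> \<le> 2 * \<Delta>"
        using M1[of K] \<Delta>1 by (simp add: abs_mult flip: right_diff_distrib)
      then have "(of_int (M K) * \<bar>u - v\<bar>)\<^sup>2 \<le> (2 * \<Delta>)\<^sup>2"
        using M1[of K] by (intro power_mono) auto
      then have "(of_int (M K))\<^sup>2 * (u - v)\<^sup>2 \<le> 4 * \<Delta> * \<Delta>"
        by (simp add: power_mult_distrib power2_eq_square[of \<Delta>])
      \<comment> \<open>One factor \<open>\<Delta>\<close> is bounded by the number of children, the
        other by \<open>sep\<close>, so a single power of the distance stands against the square of
        \<open>u - v\<close>.\<close>
      also have "\<dots> \<le> 4 * of_int (N k) * (2 * q K * \<bar>X u - X v\<bar>)"
        using sep \<Delta>N \<Delta>1 by (intro mult_mono) auto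
      also have "\<dots> = (q K / 8) * (64 * of_int (N k) * \<bar>X u - X v\<bar>)" by simp
      also have "\<dots> \<le> (of_int (N k) * of_int (M k) ^ 2 / r 0) * (64 * of_int (N k) * \<bar>X u - X v\<bar>)"
      proof (rule mult_right_mono)
        have "q K / 8 * r 0 \<le> q K / 8 * ((of_int (M k))\<^sup>2 * r k)"
          using Mr[of k] q0[of K] by (intro mult_left_mono) auto
        also have "\<dots> = (q K * r k / 8) * (of_int (M k))\<^sup>2" by simp
        also have "\<dots> \<le> of_int (N k) * (of_int (M k))\<^sup>2"
          using N_ge[of k] by (intro mult_right_mono) (auto simp: k)
        finally show "q K / 8 \<le> of_int (N k) * (of_int (M k))\<^sup>2 / r 0"
          using r0[of 0] by (simp add: pos_le_divide_eq)
        show "0 \<le> 64 * of_int (N k) * \<bar>X u - X v\<bar>" using N2[of k] by simp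
      qed
      also have "\<dots> = (of_int (M K))\<^sup>2 * (64 / r 0 * \<bar>X u - X v\<bar>)"
        by (simp add: k M_Suc power2_eq_square)
      finally show ?thesis by (rule mult_left_le_imp_le) (use M1[of K] in simp)
    qed simp
  qed
qed

section \<open>The wave and its cocycle\<close>

lemma int_dist_eq_abs:
  assumes "\<bar>t - of_int n\<bar> \<le> 1 / 2"
  shows "int_dist t = \<bar>t - of_int n\<bar>"
proof (rule antisym[OF int_dist_le])
  show "\<bar>t - of_int n\<bar> \<le> int_dist t"
  proof (cases "round t = n")
    case False
    then have "1 \<le> \<bar>real_of_int (n - round t)\<bar>" by linarith
    then show ?thesis using assms unfolding int_dist_def by (simp add: abs_if split: if_splits)
  qed (simp add: int_dist_def)
qed

text \<open>An even zigzag of slopes 1 and -1, steepened to slope 256 and cut off at height 1. It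
  touches zero from above at 0, crosses downwards at 1/4, touches from below at 1/2 and crosses
  upwards at 3/4.\<close>

definition trapezoid_wave :: "real \<Rightarrow> real" where
  "trapezoid_wave t = max (-1) (min 1 (256 * min (int_dist t) (max (1/4 - int_dist t) (int_dist t - 1/2))))"

text \<open>The zero of the wave with sign \<open>s1\<close> on its left and \<open>s2\<close> on
  its right.\<close>

fun sign_phase :: "sign \<Rightarrow> sign \<Rightarrow> real" where
  "sign_phase Plus Plus = 0"
| "sign_phase Plus Minus = 1/4"
| "sign_phase Minus Minus = 1/2"
| "sign_phase Minus Plus = 3/4"

fun sign_val :: "sign \<Rightarrow> real" where
  "sign_val Minus = -1"
| "sign_val Plus = 1"

lemma sign_phase_bounds: "0 \<le> sign_phase s1 s2" "sign_phase s1 s2 < 1"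
  by (cases s1; cases s2; simp)+

lemma trapezoid_wave_add_int: "trapezoid_wave (t + of_int n) = trapezoid_wave t"
  by (simp add: trapezoid_wave_def int_dist_add_int)

lemma abs_trapezoid_wave_le: "\<bar>trapezoid_wave t\<bar> \<le> 1"
  by (simp add: trapezoid_wave_def)

lemma trapezoid_wave_lipschitz: "\<bar>trapezoid_wave s - trapezoid_wave t\<bar> \<le> 256 * \<bar>s - t\<bar>"
proof -
  have "\<bar>int_dist s - int_dist t\<bar> \<le> \<bar>s - t\<bar>"
    using int_dist_triangle[of "s - t" t] int_dist_triangle[of "t - s" s]
      int_dist_le[of "s - t" 0] int_dist_le[of "t - s" 0] by simp
  then show ?thesis
    unfolding trapezoid_wave_def by (smt (verit))
qed

lemma continuous_on_trapezoid_wave: "continuous_on A trapezoid_wave"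
proof -
  have "256-lipschitz_on A trapezoid_wave"
    using trapezoid_wave_lipschitz by (auto intro!: lipschitz_onI simp: dist_real_def)
  then show ?thesis by (rule lipschitz_on_continuous_on)
qed

text \<open>Neighbouring zeros are 1/4 apart and the zigzag peaks halfway, so up to distance 1/8
  only the cut-off interrupts linear growth.\<close>

lemma trapezoid_wave_right:
  assumes "0 \<le> t" "t \<le> 1/8"
  shows "sign_val s2 * trapezoid_wave (sign_phase s1 s2 + t) = min 1 (256 * t)"
proof -
  have "int_dist (t + x) = (if t + x \<le> 1/2 then t + x else 1 - (t + x))" if "0 \<le> x" "x \<le> 3/4" for x
    using int_dist_eq_abs[of "t + x" 0] int_dist_eq_abs[of "t + x" 1] assms that by auto
  from this[of 0] this[of "1/4"] this[of "1/2"] this[of "3/4"] show ?thesis using assms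
    by (cases s1; cases s2; simp add: trapezoid_wave_def add.commute; linarith)
qed

lemma trapezoid_wave_left:
  assumes "0 \<le> t" "t \<le> 1/8"
  shows "sign_val s1 * trapezoid_wave (sign_phase s1 s2 - t) = min 1 (256 * t)"
proof -
  have "int_dist (x - t) = (if x - t \<le> 1/2 then \<bar>x - t\<bar> else 1 - (x - t))" if "0 \<le> x" "x \<le> 3/4" for x
  proof (cases "x - t \<le> 1/2")
    case True
    then have "\<bar>x - t - of_int 0\<bar> \<le> 1/2" using assms that by linarith
    from int_dist_eq_abs[OF this] True show ?thesis by simp
  next
    case False
    then have "\<bar>x - t - of_int 1\<bar> \<le> 1/2" using assms that by linarith
    from int_dist_eq_abs[OF this] False assms that show ?thesis by simp
  qed
  from this[of 0] this[of "1/4"] this[of "1/2"] this[of "3/4"] show ?thesis using assms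
    by (cases s1; cases s2; simp add: trapezoid_wave_def; linarith)
qed

text \<open>Only the fractional part of \<open>c\<close> matters; the piece of the shifted interval
  beyond 1 is moved back by one period.\<close>

lemma integral_periodic_shift:
  fixes f :: "real \<Rightarrow> real"
  assumes f: "\<And>A. continuous_on A f" and per: "\<And>t n. f (t + of_int n) = f t"
  shows "integral {0..1} (\<lambda>t. f (t + c)) = integral {0..1} f"
proof -
  define s where "s = frac c"
  have s: "0 \<le> s" "s \<le> 1" using frac_lt_1[of c] by (simp_all add: s_def)
  have int: "f integrable_on {x..y}" for x y by (intro integrable_continuous_real f)
  have "f (t + c) = f (t + s)" for t
    using per[of "t + s" "\<lfloor>c\<rfloor>"] by (simp add: s_def frac_def)
  then have "integral {0..1} (\<lambda>t. f (t + c)) = integral {s..1 + s} f"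
    using integral_shift_Icc_real[of 0 1 f s] by (simp add: o_def add.commute)
  also have "\<dots> = integral {s..1} f + integral {1..1 + s} f"
    using s by (intro Henstock_Kurzweil_Integration.integral_combine[symmetric] int) auto
  also have "integral {1..1 + s} f = integral {0..s} f"
    using integral_shift_Icc_real[of 0 s f 1] per[of _ 1] by (simp add: o_def add.commute)
  also have "integral {s..1} f + integral {0..s} f = integral {0..1} f"
    using s by (subst add.commute) (intro Henstock_Kurzweil_Integration.integral_combine int; simp)
  finally show ?thesis .
qed

section \<open>The coboundary series and its Birkhoff sums\<close>

locale resonant_multiples =
  fixes a :: real and q :: "nat \<Rightarrow> nat" and p :: "nat \<Rightarrow> int"
  assumes window: "1 / 16 ^ Suc k < real (q k) * a - of_int (p k)"
    "real (q k) * a - of_int (p k) < 2 / 16 ^ Suc k"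
begin

definition \<delta> :: "nat \<Rightarrow> real" where "\<delta> k = real (q k) * a - of_int (p k)"

text \<open>The telescoped m-th Birkhoff sum of the k-th coboundary, for either sign of
  \<open>m\<close>; for \<open>m = 1\<close> it is the coboundary itself.\<close>

definition increment :: "int \<Rightarrow> real \<Rightarrow> nat \<Rightarrow> real" where
  "increment m t k = 8 ^ k * (trapezoid_wave (real (q k) * (t + of_int m * a)) - trapezoid_wave (real (q k) * t))"

definition cocycle :: "int \<Rightarrow> real \<Rightarrow> real" where
  "cocycle m t = (\<Sum>k. increment m t k)"

lemma increment_eq:
  "increment m t k = 8 ^ k * (trapezoid_wave (real (q k) * t + of_int m * \<delta> k) - trapezoid_wave (real (q k) * t))"
proof -
  have "real (q k) * (t + of_int m * a) = (real (q k) * t + of_int m * \<delta> k) + of_int (m * p k)"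
    by (simp add: \<delta>_def algebra_simps)
  then show ?thesis unfolding increment_def by (simp only: trapezoid_wave_add_int)
qed

text \<open>The Lipschitz constant 256 meets \<open>\<delta> k < 2 / 16 ^ Suc k\<close>; the
  amplitude \<open>8 ^ k\<close> then leaves a geometric bound uniform in \<open>t\<close>, on which
  summability and uniform convergence rest.\<close>

lemma abs_increment_le: "\<bar>increment m t k\<bar> \<le> 32 * \<bar>of_int m\<bar> * (1/2) ^ k"
proof -
  have "\<bar>increment m t k\<bar> \<le> 8 ^ k * (256 * \<bar>of_int m * \<delta> k\<bar>)"
    unfolding increment_eq using trapezoid_wave_lipschitz[of "real (q k) * t + of_int m * \<delta> k" "real (q k) * t"]
    by (simp add: abs_mult)
  also have "\<dots> = 8 ^ k * (256 * (\<bar>of_int m\<bar> * \<bar>\<delta> k\<bar>))" by (simp add: abs_mult)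
  also have "\<dots> \<le> 8 ^ k * (256 * (\<bar>of_int m\<bar> * (2 / 16 ^ Suc k)))"
    using window[of k] less_trans[OF _ window(1), of 0 k]
    by (intro mult_left_mono) (auto simp: \<delta>_def)
  also have "\<dots> = 32 * \<bar>of_int m\<bar> * (8 ^ k / 16 ^ k)" by simp
  also have "8 ^ k / 16 ^ k = (1/2 :: real) ^ k" by (simp flip: power_divide)
  finally show ?thesis by simp
qed

lemma summable_increment: "summable (increment m t)"
  by (rule summable_comparison_test'[where g = "\<lambda>k. 32 * \<bar>of_int m\<bar> * (1/2) ^ k"])
     (auto intro!: summable_mult summable_geometric abs_increment_le)

lemma cocycle_0 [simp]: "cocycle 0 t = 0"
  by (simp add: cocycle_def increment_def)

lemma cocycle_add_1: "cocycle (m + 1) t = cocycle m t + cocycle 1 (t + of_int m * a)"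
proof -
  have "increment (m + 1) t k = increment m t k + increment 1 (t + of_int m * a) k" for k
    by (simp add: increment_def algebra_simps)
  then have "increment (m + 1) t = (\<lambda>k. increment m t k + increment 1 (t + of_int m * a) k)" ..
  then show ?thesis by (simp add: cocycle_def suminf_add summable_increment)
qed

lemma cocycle_add_int: "cocycle m (t + of_int n) = cocycle m t"
proof -
  have "increment m (t + of_int n) k = increment m t k" for k
  proof -
    have "real (q k) * (t + of_int n) = real (q k) * t + of_int (int (q k) * n)"
      "real (q k) * (t + of_int n + of_int m * a) = real (q k) * (t + of_int m * a) + of_int (int (q k) * n)"
      by (simp_all add: algebra_simps)
    then show ?thesis unfolding increment_def by (simp only: trapezoid_wave_add_int)
  qed
  then show ?thesis by (simp add: cocycle_def)
qed

lemma continuous_on_increment: "continuous_on A (\<lambda>t. increment m t k)"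
  unfolding increment_def
  by (intro continuous_intros continuous_on_compose2[OF continuous_on_trapezoid_wave[of UNIV]]) auto

lemma uniform_limit_cocycle:
  "uniform_limit A (\<lambda>n t. \<Sum>k<n. increment m t k) (cocycle m) sequentially"
  unfolding cocycle_def
  by (rule Weierstrass_m_test[where M = "\<lambda>k. 32 * \<bar>of_int m\<bar> * (1/2) ^ k"])
     (auto intro!: summable_mult summable_geometric abs_increment_le)

lemma continuous_on_cocycle: "continuous_on A (cocycle m)"
  by (rule uniform_limit_theorem[OF _ uniform_limit_cocycle])
     (auto intro!: continuous_on_sum continuous_on_increment always_eventually)

definition \<phi> :: "circle \<Rightarrow> real" where "\<phi> x = cocycle 1 (rep_circle x)"

lemma \<phi>_circle_of: "\<phi> (circle_of t) = cocycle 1 t"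
proof -
  have "int_cong (rep_circle (circle_of t)) t"
    by (rule Quotient3_rep_abs[OF Quotient3_circle]) (simp add: int_cong_def)
  then obtain n where "rep_circle (circle_of t) = t + of_int n"
    by (auto simp: int_cong_def elim!: Ints_cases)
      (metis add.commute diff_add_cancel)
  then show ?thesis by (simp add: \<phi>_def cocycle_add_int)
qed

lemma circle_of_rep: "circle_of (rep_circle x) = x"
  by (rule Quotient3_abs_rep[OF Quotient3_circle])

lemma continuous_\<phi>: "continuous_on UNIV \<phi>"
  unfolding continuous_on_iff
proof safe
  fix x :: circle and e :: real assume "e > 0"
  define t where "t = rep_circle x"
  have "continuous_on UNIV (cocycle 1)" by (rule continuous_on_cocycle)
  then obtain d where d: "d > 0" "\<And>s. dist s t < d \<Longrightarrow> dist (cocycle 1 s) (cocycle 1 t) < e"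
    using \<open>e > 0\<close> unfolding continuous_on_iff by blast
  have "dist (\<phi> y) (\<phi> x) < e" if "dist y x < d" for y
  proof -
    define s where "s = rep_circle y"
    \<comment> \<open>Subtracting \<open>n\<close> makes the representative of \<open>y\<close> as
      close to \<open>t\<close> as \<open>y\<close> is to \<open>x\<close> on the circle.\<close>
    define n where "n = round (s - t)"
    have xy: "x = circle_of t" "y = circle_of s" by (simp_all add: t_def s_def circle_of_rep)
    have "\<bar>s - t - of_int n\<bar> < d"
      using that by (simp add: xy dist_circle.abs_eq int_dist_def n_def)
    then have "dist (s + of_int (- n)) t < d" by (simp add: dist_real_def algebra_simps)
    then have "dist (cocycle 1 (s + of_int (- n))) (cocycle 1 t) < e" by (rule d)
    then show ?thesis unfolding cocycle_add_int by (simp add: xy \<phi>_circle_of)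
  qed
  with d(1) show "\<exists>d>0. \<forall>x'\<in>UNIV. dist x' x < d \<longrightarrow> dist (\<phi> x') (\<phi> x) < e" by blast
qed

lemma birkhoff_sum_\<phi>: "birkhoff_sum (circle_of a) \<phi> m (circle_of t) = cocycle m t"
proof -
  have pos: "(\<Sum>k\<in>{0..int n - 1}. \<phi> (circle_of t + int_multiple k (circle_of a))) = cocycle (int n) t" for n
  proof (induction n)
    case (Suc n)
    have "{0..int (Suc n) - 1} = insert (int n) {0..int n - 1}" by auto
    then show ?case using Suc cocycle_add_1[of "int n" t]
      by (simp add: int_multiple.abs_eq plus_circle.abs_eq \<phi>_circle_of add.commute)
  qed simp
  have neg: "- (\<Sum>k\<in>{1..int n}. \<phi> (circle_of t - int_multiple k (circle_of a))) = cocycle (- int n) t" for n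
  proof (induction n)
    case (Suc n)
    have "{1..int (Suc n)} = insert (int (Suc n)) {1..int n}" by auto
    then show ?case using Suc cocycle_add_1[of "- int (Suc n)" t]
      by (simp add: int_multiple.abs_eq minus_circle.abs_eq \<phi>_circle_of algebra_simps)
  qed simp
  show ?thesis
    using pos[of "nat m"] neg[of "nat (- m)"] by (cases "m \<ge> 0") (simp_all add: birkhoff_sum_def)
qed

text \<open>Each summand is a coboundary of a continuous periodic function and integrates to 0;
  uniform convergence carries this over to the sum.\<close>

lemma integral_\<phi>: "(LINT x|circle_lebesgue. \<phi> x) = 0"
proof -
  have meas: "circle_of \<in> measurable (restrict_space lborel {0..<1}) borel"
    by (intro measurable_restrict_space1)
       (simp add: borel_measurable_continuous_onI continuous_on_circle_of)
  have [measurable]: "cocycle 1 \<in> borel_measurable borel"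
    by (intro borel_measurable_continuous_onI continuous_on_cocycle)
  have "(LINT x|circle_lebesgue. \<phi> x) = (LINT t|restrict_space lborel {0..<1}. cocycle 1 t)"
    unfolding circle_lebesgue_def
    by (subst integral_distr[OF meas])
       (auto intro: borel_measurable_continuous_onI continuous_\<phi> simp: \<phi>_circle_of)
  also have "\<dots> = (LINT t:{0..<1}|lborel. cocycle 1 t)"
    by (subst integral_restrict_space) (auto simp: set_lebesgue_integral_def)
  also have "\<dots> = (LINT t:{0..1}|lborel. cocycle 1 t)"
    unfolding set_lebesgue_integral_def
    by (intro integral_cong_AE)
       (auto intro!: eventually_mono[OF AE_lborel_singleton[of 1]] split: split_indicator)
  also have "\<dots> = integral {0..1} (cocycle 1)"
    by (intro set_borel_integral_eq_integral(2) borel_integrable_atLeastAtMost' continuous_on_cocycle)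
  also have "\<dots> = 0"
  proof -
    have zero: "integral {0..1} (\<lambda>t. increment 1 t k) = 0" for k
    proof -
      define g where "g t = 8 ^ k * trapezoid_wave (real (q k) * t)" for t
      have g: "continuous_on A g" for A
        unfolding g_def by (intro continuous_intros continuous_on_compose2[OF continuous_on_trapezoid_wave[of UNIV]]) auto
      have per: "g (t + of_int n) = g t" for t n
      proof -
        have "real (q k) * (t + of_int n) = real (q k) * t + of_int (int (q k) * n)"
          by (simp add: algebra_simps)
        then show ?thesis unfolding g_def by (simp only: trapezoid_wave_add_int)
      qed
      have "integral {0..1} (\<lambda>t. increment 1 t k) = integral {0..1} (\<lambda>t. g (t + a) - g t)"
        by (simp add: increment_def g_def algebra_simps)
      also have "\<dots> = integral {0..1} (\<lambda>t. g (t + a)) - integral {0..1} g"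
        by (intro integral_diff integrable_continuous_real continuous_on_compose2[OF g[of UNIV]] g continuous_intros) auto
      also have "\<dots> = 0" using integral_periodic_shift[of g a, OF g per] by simp
      finally show ?thesis .
    qed
    obtain I J where I: "\<And>n. ((\<lambda>t. \<Sum>k<n. increment 1 t k) has_integral I n) {0..1}"
      and J: "(cocycle 1 has_integral J) {0..1}" and lim: "I \<longlonglongrightarrow> J"
      by (rule uniform_limit_integral[where f = "\<lambda>n t. \<Sum>k<n. increment 1 t k", OF uniform_limit_cocycle[where A = "{0..1}" and m = 1]])
         (auto intro: continuous_on_sum continuous_on_increment)
    have "I n = 0" for n
    proof -
      have "I n = integral {0..1} (\<lambda>t. \<Sum>k<n. increment 1 t k)"
        by (rule integral_unique[OF I, symmetric])
      also have "\<dots> = (\<Sum>k<n. integral {0..1} (\<lambda>t. increment 1 t k))"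
        by (intro integral_sum integrable_continuous_real continuous_on_increment) auto
      finally show ?thesis by (simp add: zero)
    qed
    then have "J = 0" using lim LIMSEQ_unique[of I J 0] by (metis tendsto_const ext)
    then show ?thesis using J by (simp add: integral_unique)
  qed
  finally show ?thesis .
qed

text \<open>Here \<open>\<sigma>\<close> is the direction of time and \<open>b\<close> the wanted
  sign. If \<open>16 ^ K \<le> n < 16 ^ Suc K\<close>, the term at \<open>Suc K\<close> contributes
  \<open>8 ^ Suc K\<close>, the earlier ones lose less than half of it, and the later ones are
  nonnegative, all up to phase errors of total size at most 4. The square root enters because
  \<open>sqrt n \<le> 4 ^ Suc K\<close>.\<close>

lemma cocycle_growth:
  fixes n :: nat and \<sigma> :: int and b \<theta> t :: real
  assumes n: "n > 0" and b: "\<bar>b\<bar> = 1" and \<theta>: "trapezoid_wave \<theta> = 0"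
    and side: "\<And>\<tau>. 0 \<le> \<tau> \<Longrightarrow> \<tau> \<le> 1/8 \<Longrightarrow> b * trapezoid_wave (\<theta> + of_int \<sigma> * \<tau>) = min 1 (256 * \<tau>)"
    and t: "\<And>k. \<exists>j::int. real (q k) * t \<in> {of_int j + \<theta>..of_int j + \<theta> + 1 / 16 ^ k / 256}"
  shows "b * cocycle (\<sigma> * int n) t \<ge> sqrt n / 2 - 4"
proof -
  \<comment> \<open>\<open>c k\<close> is the \<open>k\<close>-th increment for the exact phase \<open>\<theta>\<close>; the geometric term in \<open>f\<close> absorbs the
    phase errors.\<close>
  define c where "c k = 8 ^ k * (b * trapezoid_wave (\<theta> + of_int \<sigma> * (n * \<delta> k)))" for k
  define f where "f k = b * increment (\<sigma> * int n) t k + 2 * (1/2) ^ k" for k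
  have lower: "c k \<le> f k" for k
  proof -
    obtain j :: int and e where e: "real (q k) * t = \<theta> + e + of_int j" "0 \<le> e" "e \<le> 1 / 16 ^ k / 256"
    proof -
      obtain j :: int where "real (q k) * t \<in> {of_int j + \<theta>..of_int j + \<theta> + 1 / 16 ^ k / 256}" using t by blast
      then show thesis by (intro that[of "real (q k) * t - of_int j - \<theta>" j]) auto
    qed
    let ?y = "\<theta> + of_int \<sigma> * (n * \<delta> k)"
    have w1: "trapezoid_wave (real (q k) * t + of_int (\<sigma> * int n) * \<delta> k) = trapezoid_wave (?y + e)"
    proof -
      have "real (q k) * t + of_int (\<sigma> * int n) * \<delta> k = ?y + e + of_int j" by (simp add: e(1))
      then show ?thesis by (simp only: trapezoid_wave_add_int)
    qed
    have w2: "trapezoid_wave (real (q k) * t) = trapezoid_wave (\<theta> + e)"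
      unfolding e(1) by (rule trapezoid_wave_add_int)
    \<comment> \<open>The phase tolerance carries the factor 1/256 to cancel the Lipschitz
      constant.\<close>
    have "\<bar>trapezoid_wave (?y + e) - trapezoid_wave ?y\<bar> \<le> 1 / 16 ^ k"
      "\<bar>trapezoid_wave (\<theta> + e)\<bar> \<le> 1 / 16 ^ k"
      using trapezoid_wave_lipschitz[of "?y + e" ?y] trapezoid_wave_lipschitz[of "\<theta> + e" \<theta>] e \<theta> by auto
    moreover have "b = 1 \<or> b = -1" using b by linarith
    ultimately have "b * trapezoid_wave ?y - 2 * (1 / 16 ^ k) \<le> b * (trapezoid_wave (?y + e) - trapezoid_wave (\<theta> + e))"
      by (elim disjE) (auto simp: abs_le_iff)
    then have "8 ^ k * (b * trapezoid_wave ?y - 2 * (1 / 16 ^ k)) \<le> 8 ^ k * (b * (trapezoid_wave (?y + e) - trapezoid_wave (\<theta> + e)))"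
      by (intro mult_left_mono) auto
    moreover have "8 ^ k * (1 / 16 ^ k) = (1/2 :: real) ^ k" by (simp flip: power_divide)
    ultimately show ?thesis
      unfolding f_def c_def increment_eq w1 w2 by (simp add: algebra_simps)
  qed
  have "\<exists>K. n < 16 ^ K" by (rule exI[of _ n]) (simp add: power_gt_expt)
  define L where "L = (LEAST K. n < 16 ^ K)"
  have L: "n < 16 ^ L" unfolding L_def by (rule LeastI_ex) fact
  have "L \<noteq> 0" using L n by (auto intro: ccontr)
  then obtain K where K: "L = Suc K" by (cases L) auto
  have lo: "16 ^ K \<le> n" using not_less_Least[of K "\<lambda>K. n < 16 ^ K"] K by (auto simp: L_def)
  have lo': "16 ^ K \<le> real n" using lo by (metis of_nat_le_iff of_nat_numeral of_nat_power)
  have hi': "real n \<le> 16 ^ Suc K" using L K by (metis less_imp_le of_nat_le_iff of_nat_numeral of_nat_power)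
  have \<delta>0: "\<delta> k > 0" for k using less_trans[OF _ window(1), of 0 k] by (simp add: \<delta>_def)
  \<comment> \<open>The factor 2 in \<open>window\<close> and k \<ge> K + 1 give 2/16, exactly the
    range where \<open>side\<close> applies.\<close>
  have small: "n * \<delta> k \<le> 1/8" if "K < k" for k
  proof -
    have "n * \<delta> k \<le> 16 ^ Suc K * (2 / 16 ^ Suc k)"
      using hi' window(2)[of k] \<delta>0[of k] by (intro mult_mono) (auto simp: \<delta>_def)
    also have "\<dots> \<le> 16 ^ k * (2 / 16 ^ Suc k)"
      using that by (intro mult_right_mono power_increasing) auto
    finally show ?thesis by simp
  qed
  have c_far: "c k \<ge> 0" if "K < k" for k
    unfolding c_def using side[OF _ small[OF that]] \<delta>0[of k] by simp
  \<comment> \<open>The displacement is at least \<open>16 ^ K / 16 ^ (K + 2) = 1/256\<close>, which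
    the slope 256 lifts to full height.\<close>
  have c_mid: "c (Suc K) = 8 ^ Suc K"
  proof -
    have "16 ^ K * (1 / 16 ^ Suc (Suc K)) \<le> n * \<delta> (Suc K)"
      using lo' window(1)[of "Suc K"] by (intro mult_mono) (auto simp: \<delta>_def)
    then have "1 \<le> 256 * (n * \<delta> (Suc K))" by simp
    then show ?thesis unfolding c_def using side[OF _ small[of "Suc K"]] \<delta>0[of "Suc K"] by simp
  qed
  have c_near: "- (8 ^ k) \<le> c k" for k
  proof -
    have "\<bar>b * trapezoid_wave (\<theta> + of_int \<sigma> * (n * \<delta> k))\<bar> \<le> 1"
      using abs_trapezoid_wave_le b by (simp add: abs_mult)
    then have "8 ^ k * (-1) \<le> c k" unfolding c_def by (intro mult_left_mono) (auto simp: abs_le_iff)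
    then show ?thesis by simp
  qed
  have geo: "7 * (\<Sum>k<j. 8 ^ k) = 8 ^ j - (1::real)" for j by (induction j) auto
  have sf: "summable f" unfolding f_def
    by (intro summable_add summable_mult summable_increment summable_geometric) auto
  have "8 ^ Suc K - (\<Sum>k<Suc K. 8 ^ k) = 8 ^ Suc K + (\<Sum>k<Suc K. - (8 ^ k :: real))" by (simp add: sum_negf)
  also have "\<dots> \<le> c (Suc K) + (\<Sum>k<Suc K. c k)" unfolding c_mid by (intro add_left_mono sum_mono c_near)
  also have "\<dots> = (\<Sum>k<Suc (Suc K). c k)" by simp
  also have "\<dots> \<le> (\<Sum>k<Suc (Suc K). f k)" by (intro sum_mono lower)
  also have "\<dots> \<le> suminf f"
  proof (rule sum_le_suminf[OF sf])
    fix k assume "k \<in> - {..<Suc (Suc K)}"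
    then show "0 \<le> f k" using c_far[of k] lower[of k] by simp
  qed auto
  also have "suminf f = b * cocycle (\<sigma> * int n) t + 4"
  proof -
    have "(\<Sum>k. 2 * (1/2) ^ k) = (4::real)" by (simp add: suminf_mult suminf_geometric)
    then show ?thesis unfolding f_def cocycle_def
      by (subst suminf_add[symmetric])
         (auto intro!: summable_mult summable_increment summable_geometric simp: suminf_mult summable_increment)
  qed
  finally have main: "8 ^ Suc K / 2 - 4 \<le> b * cocycle (\<sigma> * int n) t"
    using geo[of "Suc K"] zero_less_power[of "8::real" "Suc K"] by linarith
  have "(4 ^ j)\<^sup>2 = (16 :: real) ^ j" for j by (simp add: power2_eq_square flip: power_mult_distrib)
  then have "sqrt n \<le> sqrt ((4 ^ Suc K)\<^sup>2)" using hi' by (simp only: real_sqrt_le_mono)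
  also have "\<dots> = 4 ^ Suc K" by (simp only: real_sqrt_abs) simp
  also have "\<dots> \<le> 8 ^ Suc K" by (intro power_mono) auto
  finally show ?thesis using main by simp
qed

end

section \<open>Divergence\<close>

lemma eventually_sqrt_int_ge:
  "eventually (\<lambda>m::int. Z \<le> sqrt (nat m) / 2 - 4 \<and> m > 0) at_top"
  "eventually (\<lambda>m::int. Z \<le> sqrt (nat (- m)) / 2 - 4 \<and> m < 0) at_bot"
proof -
  define N where "N = max 1 \<lceil>(2 * (\<bar>Z\<bar> + 4))\<^sup>2\<rceil>"
  have *: "Z \<le> sqrt (nat m) / 2 - 4 \<and> m > 0" if "m \<ge> N" for m
  proof -
    have "(2 * (\<bar>Z\<bar> + 4))\<^sup>2 \<le> real_of_int N" unfolding N_def by linarith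
    also have "\<dots> \<le> real (nat m)" using that by (simp add: N_def)
    finally have "2 * (\<bar>Z\<bar> + 4) \<le> sqrt (nat m)" by (rule real_le_rsqrt)
    then have "Z \<le> sqrt (nat m) / 2 - 4" by argo
    moreover have "m > 0" using that unfolding N_def by linarith
    ultimately show ?thesis by blast
  qed
  show "eventually (\<lambda>m::int. Z \<le> sqrt (nat m) / 2 - 4 \<and> m > 0) at_top"
    unfolding eventually_at_top_linorder using * by blast
  show "eventually (\<lambda>m::int. Z \<le> sqrt (nat (- m)) / 2 - 4 \<and> m < 0) at_bot"
    unfolding eventually_at_bot_linorder using * by (intro exI[of _ "- N"]) force
qed

lemma filterlim_signed_infinity:
  assumes "\<And>Z. eventually (\<lambda>x. Z \<le> sign_val s * f x) F"
  shows "filterlim f (signed_infinity s) F"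
proof (cases s)
  case Plus
  then show ?thesis using assms by (simp add: filterlim_at_top)
next
  case Minus
  have "eventually (\<lambda>x. f x \<le> Z) F" for Z
    using assms[of "- Z"] Minus by simp
  then show ?thesis using Minus by (simp add: filterlim_at_bot)
qed

section \<open>Divergence at the Cantor points and the dimension bound\<close>

context resonant_multiples
begin

text \<open>Since \<open>\<delta> k\<close> is positive, positive times move every phase to the
  right of the zero, where the sign is \<open>s2\<close>, and negative times to the left, where it
  is \<open>s1\<close>.\<close>

lemma circle_of_in_divergence_set:
  assumes t: "\<And>k. \<exists>j::int. real (q k) * t \<in> {of_int j + sign_phase s1 s2..of_int j + sign_phase s1 s2 + 1 / 16 ^ k / 256}"
  shows "circle_of t \<in> divergence_set s1 s2 (circle_of a) \<phi>"
proof -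
  let ?\<theta> = "sign_phase s1 s2"
  have \<theta>: "trapezoid_wave ?\<theta> = 0" using trapezoid_wave_right[of 0 s2 s1] by (cases s2) auto
  have abs_sign: "\<bar>sign_val s\<bar> = 1" for s by (cases s) auto
  have right: "sqrt (nat m) / 2 - 4 \<le> sign_val s2 * cocycle m t" if "m > 0" for m
    using cocycle_growth[OF _ abs_sign \<theta> _ t, of "nat m" s2 1] trapezoid_wave_right that by simp
  have left: "sqrt (nat (- m)) / 2 - 4 \<le> sign_val s1 * cocycle m t" if "m < 0" for m
    using cocycle_growth[OF _ abs_sign \<theta> _ t, of "nat (- m)" s1 "-1"] trapezoid_wave_left that by simp
  have "filterlim (\<lambda>m. cocycle m t) (signed_infinity s2) at_top"
  proof (rule filterlim_signed_infinity)
    show "eventually (\<lambda>m. Z \<le> sign_val s2 * cocycle m t) at_top" for Z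
      using eventually_sqrt_int_ge(1)[of Z] by (rule eventually_mono) (use right in force)
  qed
  moreover have "filterlim (\<lambda>m. cocycle m t) (signed_infinity s1) at_bot"
  proof (rule filterlim_signed_infinity)
    show "eventually (\<lambda>m. Z \<le> sign_val s1 * cocycle m t) at_bot" for Z
      using eventually_sqrt_int_ge(2)[of Z] by (rule eventually_mono) (use left in force)
  qed
  ultimately show ?thesis by (simp add: divergence_set_def birkhoff_sum_\<phi>)
qed

lemma hausdorff_dim_divergence_set:
  defines "r \<equiv> \<lambda>k. (1 / 16 ^ k / 256) / real (q k)"
  assumes q: "\<And>k. q k \<ge> 1" and many: "\<And>k. 8 \<le> real (q (Suc k)) * r k"
    and fast: "\<And>k. 64 \<le> (1 / 16 ^ Suc k / 256) * real (q (Suc k)) * (r k)\<^sup>2"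
  shows "hausdorff_dim (divergence_set s1 s2 (circle_of a) \<phi>) \<ge> 1 / 2"
proof -
  have q1: "1 \<le> real (q k)" for k using q[of k] by simp
  have \<eta>: "0 < 1 / 16 ^ k / (256::real)" "1 / 16 ^ k / (256::real) \<le> 1 / 2" for k :: nat
  proof -
    have "1 / 16 ^ k \<le> (1::real)" by simp
    from divide_right_mono[OF this, of 256] show "1 / 16 ^ k / (256::real) \<le> 1 / 2"
      by (rule order_trans) auto
  qed simp
  obtain X :: "real \<Rightarrow> real" where
    X: "\<And>u k. u \<in> {0..<1} \<Longrightarrow> \<exists>j::int. real (q k) * X u \<in> {of_int j + sign_phase s1 s2..of_int j + sign_phase s1 s2 + 1 / 16 ^ k / 256}"
    and sep: "\<And>u v. u \<in> {0..<1} \<Longrightarrow> v \<in> {0..<1} \<Longrightarrow> (u - v)\<^sup>2 \<le> 64 / r 0 * \<bar>X u - X v\<bar>"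
    and near: "\<And>u v. u \<in> {0..<1} \<Longrightarrow> v \<in> {0..<1} \<Longrightarrow> \<bar>X u - X v\<bar> \<le> 1 / 2"
    using nested_phase_points[where q = "\<lambda>k. real (q k)" and \<eta> = "\<lambda>k. 1 / 16 ^ k / 256",
      OF sign_phase_bounds[of s1 s2] \<eta> q1 many[unfolded r_def] fast[unfolded r_def], folded r_def] unfolding r_def by metis
  have r0: "r 0 > 0" using q1[of 0] by (simp add: r_def)
  have "hausdorff_dim (divergence_set s1 s2 (circle_of a) \<phi>) \<ge> ennreal (1/2)"
  proof (rule hausdorff_dim_ge_inverse_holder[where \<gamma> = "\<lambda>u. circle_of (X u)" and C = "sqrt (64 / r 0)"])
    show "sqrt (64 / r 0) > 0" using r0 by simp
    fix u v :: real assume uv: "u \<in> {0..<1}" "v \<in> {0..<1}"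
    \<comment> \<open>By \<open>near\<close> the circle distance is the real one, so the square root
      of \<open>sep\<close> is the Hoelder bound with exponent 1/2.\<close>
    have "dist (circle_of (X u)) (circle_of (X v)) = \<bar>X u - X v\<bar>"
      using int_dist_eq_abs[of "X u - X v" 0] near[OF uv] by (simp add: dist_circle.abs_eq)
    then have "sqrt (64 / r 0) * dist (circle_of (X u)) (circle_of (X v)) powr (1/2) = sqrt (64 / r 0 * \<bar>X u - X v\<bar>)"
      by (simp only: powr_half_sqrt abs_ge_zero real_sqrt_mult)
    also have "\<bar>u - v\<bar> \<le> \<dots>" using sep[OF uv] by (intro real_le_rsqrt) simp
    finally show "\<bar>u - v\<bar> \<le> sqrt (64 / r 0) * dist (circle_of (X u)) (circle_of (X v)) powr (1/2)" .
  next
    show "(\<lambda>u. circle_of (X u)) ` {0..<1} \<subseteq> divergence_set s1 s2 (circle_of a) \<phi>"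
      using X circle_of_in_divergence_set by blast
  qed auto
  then show ?thesis by (simp add: divide_ennreal_def)
qed

end

theorem theorem9:
  shows "AE \<alpha> in circle_lebesgue.
    \<exists>\<phi> :: circle \<Rightarrow> real. continuous_on UNIV \<phi> \<and> (LINT x|circle_lebesgue. \<phi> x) = 0 \<and>
      (\<forall>s1 s2. hausdorff_dim (divergence_set s1 s2 \<alpha> \<phi>) \<ge> 1 / 2)"
  using AE_circle_lebesgue_irrational
proof eventually_elim
  fix \<alpha> assume "\<exists>a. \<alpha> = circle_of a \<and> a \<notin> \<rat>"
  then obtain a where \<alpha>: "\<alpha> = circle_of a" and a: "a \<notin> \<rat>" by blast
  define r :: "nat \<Rightarrow> nat \<Rightarrow> real" where "r k q = (1 / 16 ^ k / 256) / real q" for k q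
  define P where "P k q \<longleftrightarrow> q \<ge> 1 \<and>
    (\<exists>p::int. 1 / 16 ^ Suc k < real q * a - of_int p \<and> real q * a - of_int p < 2 / 16 ^ Suc k)" for k q
  have ex: "\<exists>q'>B. P k q'" for B k
  proof -
    have "1 / 16 ^ Suc k < (2 :: real) / 16 ^ Suc k" by (intro divide_strict_right_mono) auto
    from irrational_multiple_in_window[OF a this, of "max B 1"] show ?thesis
      unfolding P_def by (metis less_imp_le max_less_iff_conj)
  qed
  \<comment> \<open>Once \<open>f k\<close> is fixed, both growth conditions are mere lower bounds
    on \<open>f (Suc k)\<close>, and arbitrarily large multipliers hit the next window.\<close>
  have "\<exists>f. \<forall>k. P k (f k) \<and> (8 \<le> f (Suc k) * r k (f k) \<and>
      64 \<le> (1 / 16 ^ Suc k / 256) * f (Suc k) * (r k (f k))\<^sup>2)"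
  proof (rule dependent_nat_choice)
    show "\<exists>q. P 0 q" using ex by blast
    fix q k assume "P k q"
    then have r: "r k q > 0" by (simp add: P_def r_def)
    define D where "D = (1 / 16 ^ Suc k / 256) * (r k q)\<^sup>2"
    have D: "D > 0" using r by (simp add: D_def)
    obtain q' where q': "q' > nat \<lceil>max (8 / r k q) (64 / D)\<rceil>" "P (Suc k) q'" using ex by blast
    then have "max (8 / r k q) (64 / D) \<le> real q'" by linarith
    then have "8 \<le> q' * r k q" "64 \<le> q' * D"
      by (simp_all add: pos_divide_le_eq r D)
    then show "\<exists>q'. P (Suc k) q' \<and> (8 \<le> q' * r k q \<and> 64 \<le> (1 / 16 ^ Suc k / 256) * q' * (r k q)\<^sup>2)"
      using q'(2) by (auto simp: D_def mult_ac)
  qed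
  then obtain q where q: "\<And>k. P k (q k)" and many: "\<And>k. 8 \<le> q (Suc k) * r k (q k)"
    and fast: "\<And>k. 64 \<le> (1 / 16 ^ Suc k / 256) * q (Suc k) * (r k (q k))\<^sup>2" by metis
  have "\<forall>k. \<exists>p::int. 1 / 16 ^ Suc k < real (q k) * a - of_int p \<and> real (q k) * a - of_int p < 2 / 16 ^ Suc k"
    using q by (simp add: P_def)
  then obtain p :: "nat \<Rightarrow> int" where "\<And>k. 1 / 16 ^ Suc k < real (q k) * a - of_int (p k) \<and>
    real (q k) * a - of_int (p k) < 2 / 16 ^ Suc k" by metis
  then interpret resonant_multiples a q p by unfold_locales auto
  show "\<exists>\<phi> :: circle \<Rightarrow> real. continuous_on UNIV \<phi> \<and> (LINT x|circle_lebesgue. \<phi> x) = 0 \<and>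
      (\<forall>s1 s2. hausdorff_dim (divergence_set s1 s2 \<alpha> \<phi>) \<ge> 1 / 2)"
  proof (intro exI[of _ \<phi>] conjI allI continuous_\<phi> integral_\<phi>)
    show "1 / 2 \<le> hausdorff_dim (divergence_set s1 s2 \<alpha> \<phi>)" for s1 s2
      unfolding \<alpha> using q many fast by (intro hausdorff_dim_divergence_set) (simp_all add: P_def r_def)
  qed
qed

end
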